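(* Let $A$ be a Banach algebra and $B$ a Banach $A$-bimodule with $\tilde{Z}^\ell_{A^{**}}(B^{**})=B^{**}$. Let $D:A\to B^*$ be a derivation. Then $D''(A^{**})B^{**}\subseteq A^*$.
   Context: For a bounded bilinear map $m:X\times Y\to Z$, define $\langle m^*(z',x),y\rangle=\langle z',m(x,y)\rangle$, $\langle m^{**}(y'',z'),x\rangle=\langle y'',m^*(z',x)\rangle$, $\langle m^{***}(x'',y''),z'\rangle=\langle x'',m^{**}(y'',z')\rangle$, so $m^{***}:X^{**}\times Y^{**}\to Z^{**}$. If $\pi_\ell:A\times B\to B$, $\pi_r:B\times A\to B$ are the module actions, then $A^{**}$ carries the first Arens product (the $^{***}$-extension of the multiplication) and $B^{**}$ is a Banach $A^{**}$-bimodule with $a''b''=\pi_\ell^{***}(a'',b'')$, $b''a''=\pi_r^{***}(b'',a'')$. $B^*$ is the dual $A$-bimodule of $B$. $\tilde Z^\ell_{A^{**}}(B^{**})=\{b''\in B^{**}: a''\mapsto b''a''\text{ from }A^{**}\text{ to }B^{**}\text{ is weak}^*\text{-to-weak continuous}\}$. A derivation $D:A\to B^*$ is a bounded linear map with $D(xy)=xD(y)+D(x)y$; $D'':A^{**}\to B^{***}$ is its second adjoint. For $b'''\in B^{***}$ and $b''\in B^{**}$, $b'''b''\in A^{***}$ is defined by $\langle b'''b'',a''\rangle=\langle b''',b''a''\rangle$, and $D''(A^{**})B^{**}$ is the set of all such products with $b'''\in D''(A^{**})$; $A^*$ is identified with its canonical image in $A^{***}$. *)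

theory Defs
  imports "HOL-Analysis.Analysis" "HOL-Library.Function_Algebras"
begin

text \<open>
  The scalar field is an arbitrary \<open>'k :: real_normed_field\<close>. Its norm is multiplicative, so by
  Gelfand--Mazur this means exactly the reals or the complex numbers. The library's type of
  bounded linear functions is restricted to real scalars, hence normed spaces over \<open>'k\<close> are
  represented here by a linear subspace of a type, a scalar multiplication and a norm; addition is
  that of the type (pointwise for functions).
\<close>

record ('v, 'k) nspace =
  carr :: "'v set"
  smult :: "'k \<Rightarrow> 'v \<Rightarrow> 'v"
  nrm :: "'v \<Rightarrow> real"

definition whole :: "('k \<Rightarrow> 'v \<Rightarrow> 'v) \<Rightarrow> ('v::real_normed_vector, 'k) nspace" where
  "whole s = \<lparr>carr = UNIV, smult = s, nrm = norm\<rparr>"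

definition bounded_linear_map ::
    "('v::ab_group_add, 'k) nspace \<Rightarrow> ('w::ab_group_add, 'k) nspace \<Rightarrow> ('v \<Rightarrow> 'w) \<Rightarrow> bool" where
  "bounded_linear_map X Y T \<longleftrightarrow>
     (\<forall>x\<in>carr X. T x \<in> carr Y) \<and>
     (\<forall>x\<in>carr X. \<forall>y\<in>carr X. T (x + y) = T x + T y) \<and>
     (\<forall>c. \<forall>x\<in>carr X. T (smult X c x) = smult Y c (T x)) \<and>
     (\<exists>K. \<forall>x\<in>carr X. nrm Y (T x) \<le> K * nrm X x)"

text \<open>
  Functionals on \<open>X\<close> are total functions that vanish outside \<open>carr X\<close>; this makes
  equality of functionals on \<open>carr X\<close> equality of functions.
\<close>

definition dual ::
    "('v::ab_group_add, 'k::real_normed_field) nspace \<Rightarrow> ('v \<Rightarrow> 'k, 'k) nspace" where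
  "dual X =
     \<lparr>carr = {f. bounded_linear_map X (whole (*)) f \<and> (\<forall>x. x \<notin> carr X \<longrightarrow> f x = 0)},
      smult = (\<lambda>c f x. c * f x),
      nrm = (\<lambda>f. SUP x\<in>{x \<in> carr X. nrm X x \<le> 1}. norm (f x))\<rparr>"

text \<open>For real scalars, this is the library's dual space with its operator norm.\<close>

lemma carr_dual_whole_scaleR:
  "carr (dual (whole (scaleR :: real \<Rightarrow> 'a \<Rightarrow> 'a::real_normed_vector))) = range blinfun_apply"
proof -
  have 1: "bounded_linear f" if f: "bounded_linear_map (whole scaleR) (whole (*)) f" for f :: "'a \<Rightarrow> real"
  proof -
    obtain K where "\<forall>x. norm (f x) \<le> K * norm x"
      using f by (auto simp: bounded_linear_map_def whole_def)
    then show ?thesis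
      using f by (intro bounded_linear_intro[where K = K])
        (auto simp: bounded_linear_map_def whole_def mult.commute)
  qed
  have 2: "bounded_linear_map (whole scaleR) (whole (*)) (blinfun_apply f)" for f :: "'a \<Rightarrow>\<^sub>L real"
    using norm_blinfun[of f]
    by (auto simp: bounded_linear_map_def whole_def blinfun.add_right blinfun.scaleR_right)
  have "f \<in> range blinfun_apply" if "bounded_linear_map (whole scaleR) (whole (*)) f" for f :: "'a \<Rightarrow> real"
    using bounded_linear_Blinfun_apply[OF 1[OF that]] by (metis rangeI)
  then show ?thesis
    using 2 by (auto simp: dual_def whole_def)
qed

lemma nrm_dual_whole_scaleR:
  fixes f :: "'a::real_normed_vector \<Rightarrow>\<^sub>L real"
  shows "nrm (dual (whole scaleR)) (blinfun_apply f) = norm f"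
proof -
  have "(SUP x\<in>{x. norm x \<le> 1}. norm (f x)) = norm f"
  proof (rule antisym)
    show "(SUP x\<in>{x. norm x \<le> 1}. norm (f x)) \<le> norm f"
    proof (rule cSUP_least)
      show "{x::'a. norm x \<le> 1} \<noteq> {}"
        by (auto intro: exI[of _ 0])
      show "norm (f x) \<le> norm f" if "x \<in> {x. norm x \<le> 1}" for x
        using that norm_blinfun[of f x] mult_left_mono[of "norm x" 1 "norm f"] by auto
    qed
    have bdd: "bdd_above ((\<lambda>x. norm (f x)) ` {x. norm x \<le> 1})"
    proof (rule bdd_aboveI2)
      show "norm (f x) \<le> norm f" if "x \<in> {x. norm x \<le> 1}" for x
        using that norm_blinfun[of f x] mult_left_mono[of "norm x" 1 "norm f"] by auto
    qed
    show "norm f \<le> (SUP x\<in>{x. norm x \<le> 1}. norm (f x))" (is "_ \<le> ?S")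
    proof (rule norm_blinfun_bound)
      have "norm (f 0) \<le> ?S"
        by (rule cSUP_upper[OF _ bdd]) simp
      then show "0 \<le> ?S"
        by (simp add: blinfun.zero_right)
      show "norm (f x) \<le> ?S * norm x" for x
      proof (cases "x = 0")
        case False
        have "norm (f (x /\<^sub>R norm x)) \<le> ?S"
          by (rule cSUP_upper[OF _ bdd]) (use False in simp)
        then show ?thesis
          using False by (simp add: blinfun.scaleR_right divide_simps mult.commute)
      qed (simp add: blinfun.zero_right)
    qed
  qed
  then show ?thesis
    by (simp add: dual_def whole_def)
qed

definition canonical_embedding ::
    "('v::ab_group_add, 'k::real_normed_field) nspace \<Rightarrow> 'v \<Rightarrow> ('v \<Rightarrow> 'k) \<Rightarrow> 'k" where
  "canonical_embedding X x = (\<lambda>f. if f \<in> carr (dual X) then f x else 0)"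

text \<open>The coarsest topology on \<open>S\<close> making all functions in \<open>F\<close> continuous.\<close>

definition initial_topology :: "'v set \<Rightarrow> ('v \<Rightarrow> 'k::topological_space) set \<Rightarrow> 'v topology" where
  "initial_topology S F = topology_generated_by {{x \<in> S. \<phi> x \<in> U} | \<phi> U. \<phi> \<in> F \<and> open U}"

definition weak_topology ::
    "('v::ab_group_add, 'k::real_normed_field) nspace \<Rightarrow> 'v topology" where
  "weak_topology X = initial_topology (carr X) (carr (dual X))"

definition weak_star_topology ::
    "('v::ab_group_add, 'k::real_normed_field) nspace \<Rightarrow> ('v \<Rightarrow> 'k) topology" where
  "weak_star_topology X = initial_topology (carr (dual X)) ((\<lambda>x f. f x) ` carr X)"

text \<open>
  \<open>adj Y m\<close> is \<open>m\<^sup>*\<close>, i.e. \<open>\<langle>m\<^sup>*(z', x), y\<rangle> = \<langle>z', m(x, y)\<rangle>\<close> for \<open>y\<close> in the second factor \<open>Y\<close>.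
  The second factors of \<open>m : X \<times> Y \<rightarrow> Z\<close>, \<open>m\<^sup>* : Z\<^sup>* \<times> X \<rightarrow> Y\<^sup>*\<close> and
  \<open>m\<^sup>*\<^sup>* : Y\<^sup>*\<^sup>* \<times> Z\<^sup>* \<rightarrow> X\<^sup>*\<close> are \<open>Y\<close>, \<open>X\<close> and \<open>Z\<^sup>*\<close>.
\<close>

definition adj :: "'y set \<Rightarrow> ('x \<Rightarrow> 'y \<Rightarrow> 'z) \<Rightarrow> ('z \<Rightarrow> 'k::zero) \<Rightarrow> 'x \<Rightarrow> 'y \<Rightarrow> 'k" where
  "adj Y m z' x = (\<lambda>y. if y \<in> Y then z' (m x y) else 0)"

definition triple_adj ::
    "('x, 'k) nspace \<Rightarrow> ('y, 'k) nspace \<Rightarrow> ('z::ab_group_add, 'k::real_normed_field) nspace \<Rightarrow>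
     ('x \<Rightarrow> 'y \<Rightarrow> 'z) \<Rightarrow> (('x \<Rightarrow> 'k) \<Rightarrow> 'k) \<Rightarrow> (('y \<Rightarrow> 'k) \<Rightarrow> 'k) \<Rightarrow> ('z \<Rightarrow> 'k) \<Rightarrow> 'k" where
  "triple_adj X Y Z m = adj (carr (dual Z)) (adj (carr X) (adj (carr Y) m))"

definition adjoint_map :: "('x, 'k) nspace \<Rightarrow> ('x \<Rightarrow> 'y) \<Rightarrow> ('y \<Rightarrow> 'k::zero) \<Rightarrow> 'x \<Rightarrow> 'k" where
  "adjoint_map X T g = (\<lambda>x. if x \<in> carr X then g (T x) else 0)"

locale banach_scalars = vector_space s
  for s :: "'k::real_normed_field \<Rightarrow> 'v::banach \<Rightarrow> 'v" +
  assumes norm_scale: "norm (s c x) = norm c * norm x"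
    and scale_of_real: "s (of_real r) x = r *\<^sub>R x"

text \<open>Banach algebras need not be unital.\<close>

locale banach_algebra = banach_scalars sA
  for sA :: "'k::real_normed_field \<Rightarrow> 'a::{real_normed_algebra, banach} \<Rightarrow> 'a" +
  assumes scale_mult_left: "sA c (x * y) = sA c x * y"
    and scale_mult_right: "sA c (x * y) = x * sA c y"

locale banach_bimodule = A: banach_algebra sA + B: banach_scalars sB
  for sA :: "'k::real_normed_field \<Rightarrow> 'a::{real_normed_algebra, banach} \<Rightarrow> 'a"
    and sB :: "'k \<Rightarrow> 'b::banach \<Rightarrow> 'b" +
  fixes pi_l :: "'a \<Rightarrow> 'b \<Rightarrow> 'b" and pi_r :: "'b \<Rightarrow> 'a \<Rightarrow> 'b"
  assumes bounded_bilinear_l: "bounded_bilinear pi_l"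
    and bounded_bilinear_r: "bounded_bilinear pi_r"
    and pi_l_scale: "pi_l (sA c a) b = sB c (pi_l a b)" "pi_l a (sB c b) = sB c (pi_l a b)"
    and pi_r_scale: "pi_r (sB c b) a = sB c (pi_r b a)" "pi_r b (sA c a) = sB c (pi_r b a)"
    and pi_l_mult: "pi_l (x * y) b = pi_l x (pi_l y b)"
    and pi_r_mult: "pi_r b (x * y) = pi_r (pi_r b x) y"
    and pi_l_pi_r: "pi_r (pi_l x b) y = pi_l x (pi_r b y)"

definition bidual_right_action ::
    "('k::real_normed_field \<Rightarrow> 'a::real_normed_vector \<Rightarrow> 'a) \<Rightarrow>
     ('k \<Rightarrow> 'b::real_normed_vector \<Rightarrow> 'b) \<Rightarrow> ('b \<Rightarrow> 'a \<Rightarrow> 'b) \<Rightarrow>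
     (('b \<Rightarrow> 'k) \<Rightarrow> 'k) \<Rightarrow> (('a \<Rightarrow> 'k) \<Rightarrow> 'k) \<Rightarrow> ('b \<Rightarrow> 'k) \<Rightarrow> 'k" where
  "bidual_right_action sA sB pi_r = triple_adj (whole sB) (whole sA) (whole sB) pi_r"

definition Ztilde_l ::
    "('k::real_normed_field \<Rightarrow> 'a::real_normed_vector \<Rightarrow> 'a) \<Rightarrow>
     ('k \<Rightarrow> 'b::real_normed_vector \<Rightarrow> 'b) \<Rightarrow> ('b \<Rightarrow> 'a \<Rightarrow> 'b) \<Rightarrow> (('b \<Rightarrow> 'k) \<Rightarrow> 'k) set" where
  "Ztilde_l sA sB pi_r =
     {b'' \<in> carr (dual (dual (whole sB))).
        continuous_map (weak_star_topology (dual (whole sA)))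
                       (weak_topology (dual (dual (whole sB))))
                       (\<lambda>a''. bidual_right_action sA sB pi_r b'' a'')}"

text \<open>
  The module actions on \<open>B\<^sup>*\<close> are
  \<open>\<langle>a b', b\<rangle> = \<langle>b', b a\<rangle>\<close> and \<open>\<langle>b' a, b\<rangle> = \<langle>b', a b\<rangle>\<close>.
\<close>

definition dual_left_action :: "('b \<Rightarrow> 'a \<Rightarrow> 'b) \<Rightarrow> 'a \<Rightarrow> ('b \<Rightarrow> 'k) \<Rightarrow> 'b \<Rightarrow> 'k" where
  "dual_left_action pi_r a b' = (\<lambda>b. b' (pi_r b a))"

definition dual_right_action :: "('a \<Rightarrow> 'b \<Rightarrow> 'b) \<Rightarrow> ('b \<Rightarrow> 'k) \<Rightarrow> 'a \<Rightarrow> 'b \<Rightarrow> 'k" where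
  "dual_right_action pi_l b' a = (\<lambda>b. b' (pi_l a b))"

definition derivation_into_dual ::
    "('k::real_normed_field \<Rightarrow> 'a::real_normed_algebra \<Rightarrow> 'a) \<Rightarrow>
     ('k \<Rightarrow> 'b::real_normed_vector \<Rightarrow> 'b) \<Rightarrow> ('a \<Rightarrow> 'b \<Rightarrow> 'b) \<Rightarrow> ('b \<Rightarrow> 'a \<Rightarrow> 'b) \<Rightarrow>
     ('a \<Rightarrow> 'b \<Rightarrow> 'k) \<Rightarrow> bool" where
  "derivation_into_dual sA sB pi_l pi_r D \<longleftrightarrow>
     bounded_linear_map (whole sA) (dual (whole sB)) D \<and>
     (\<forall>x y. D (x * y) = dual_left_action pi_r x (D y) + dual_right_action pi_l (D x) y)"

definition second_adjoint ::
    "('k::real_normed_field \<Rightarrow> 'a::real_normed_vector \<Rightarrow> 'a) \<Rightarrow>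
     ('k \<Rightarrow> 'b::real_normed_vector \<Rightarrow> 'b) \<Rightarrow> ('a \<Rightarrow> 'b \<Rightarrow> 'k) \<Rightarrow>
     (('a \<Rightarrow> 'k) \<Rightarrow> 'k) \<Rightarrow> (('b \<Rightarrow> 'k) \<Rightarrow> 'k) \<Rightarrow> 'k" where
  "second_adjoint sA sB D =
     adjoint_map (dual (dual (whole sB))) (adjoint_map (whole sA) D)"

text \<open>The product \<open>b''' b''\<close> in \<open>A\<^sup>*\<^sup>*\<^sup>*\<close>.\<close>

definition tridual_bidual_prod ::
    "('k::real_normed_field \<Rightarrow> 'a::real_normed_vector \<Rightarrow> 'a) \<Rightarrow>
     ('k \<Rightarrow> 'b::real_normed_vector \<Rightarrow> 'b) \<Rightarrow> ('b \<Rightarrow> 'a \<Rightarrow> 'b) \<Rightarrow>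
     ((('b \<Rightarrow> 'k) \<Rightarrow> 'k) \<Rightarrow> 'k) \<Rightarrow> (('b \<Rightarrow> 'k) \<Rightarrow> 'k) \<Rightarrow> (('a \<Rightarrow> 'k) \<Rightarrow> 'k) \<Rightarrow> 'k" where
  "tridual_bidual_prod sA sB pi_r b''' b'' =
     (\<lambda>a''. if a'' \<in> carr (dual (dual (whole sA)))
            then b''' (bidual_right_action sA sB pi_r b'' a'') else 0)"

end

theory Submission
  imports Defs
begin

text \<open>
  The idea is that \<open>A\<^sup>*\<close>, inside \<open>A\<^sup>*\<^sup>*\<^sup>*\<close>, is exactly the set of weak-star continuous linear
  functionals on \<open>A\<^sup>*\<^sup>*\<close>. Take \<open>b''' = D''(u)\<close> with \<open>u\<close> in \<open>A\<^sup>*\<^sup>*\<close>, and \<open>b''\<close> in \<open>B\<^sup>*\<^sup>*\<close>. The product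
  \<open>b''' b''\<close> is the composition of \<open>a'' \<mapsto> b'' a''\<close> with \<open>b'''\<close>. The first map is weak-star-to-weak
  continuous, because \<open>b''\<close> belongs to the left topological centre; the second is weakly continuous,
  because \<open>b'''\<close> is a bounded functional on \<open>B\<^sup>*\<^sup>*\<close>: second adjoints of bounded maps are
  bounded (\<open>bounded_linear_map_adjoint_map\<close>, used twice). So \<open>b''' b''\<close> is weak-star continuous,
  and \<open>weak_star_continuous_imp_evaluation\<close> gives an element of \<open>A\<^sup>*\<close> that represents it.

  That last lemma is purely algebraic once continuity at \<open>0\<close> is used: a weak-star neighbourhood
  of \<open>0\<close> contains a subspace cut out by finitely many evaluations; a linear functional that is bounded
  by \<open>1\<close> on a subspace vanishes there; and a functional that vanishes on the common kernel of
  finitely many functionals is a linear combination of them.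

  Linearity of \<open>a'' \<mapsto> b'' a''\<close> comes from the adjoint lemma as well: for \<open>z'\<close> in \<open>B\<^sup>*\<close>, the functional
  \<open>\<langle>\<pi>\<^sub>r\<^sup>*\<^sup>*(a'', z'), b\<rangle> = \<langle>a'', z' \<circ> \<pi>\<^sub>r(b, \<cdot>)\<rangle>\<close> is the adjoint of the bounded map
  \<open>b \<mapsto> z' \<circ> \<pi>\<^sub>r(b, \<cdot>)\<close> from \<open>B\<close> to \<open>A\<^sup>*\<close>, applied to \<open>a''\<close>.
\<close>

section \<open>Seminormed spaces and their duals\<close>

text \<open>
  These are the properties that pass from a space to its dual and that give
  \<open>\<bar>f x\<bar> \<le> \<parallel>f\<parallel> \<parallel>x\<parallel>\<close>: where \<open>\<parallel>x\<parallel> = 0\<close>, boundedness of \<open>f\<close> gives \<open>f x = 0\<close>.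
\<close>

definition seminormed :: "('v::ab_group_add, 'k::real_normed_field) nspace \<Rightarrow> bool" where
  "seminormed X \<longleftrightarrow> carr X \<noteq> {} \<and>
     (\<forall>x\<in>carr X. \<forall>y\<in>carr X. x + y \<in> carr X) \<and>
     (\<forall>c. \<forall>x\<in>carr X. smult X c x \<in> carr X \<and> nrm X (smult X c x) = norm c * nrm X x) \<and>
     (\<forall>x\<in>carr X. 0 \<le> nrm X x)"

lemma seminormed_whole:
  assumes "banach_scalars s"
  shows "seminormed (whole s)"
  using banach_scalars.norm_scale[OF assms] by (auto simp: seminormed_def whole_def)

lemma carr_whole [simp]: "carr (whole s) = UNIV"
  and smult_whole [simp]: "smult (whole s) = s"
  and nrm_whole [simp]: "nrm (whole s) = norm"
  by (simp_all add: whole_def)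

lemma smult_dual [simp]: "smult (dual X) c f = (\<lambda>x. c * f x)"
  by (simp add: dual_def)

lemma mem_dual_iff:
  "f \<in> carr (dual X) \<longleftrightarrow>
     (\<forall>x\<in>carr X. \<forall>y\<in>carr X. f (x + y) = f x + f y) \<and>
     (\<forall>c. \<forall>x\<in>carr X. f (smult X c x) = c * f x) \<and>
     (\<exists>K. \<forall>x\<in>carr X. norm (f x) \<le> K * nrm X x) \<and>
     (\<forall>x. x \<notin> carr X \<longrightarrow> f x = 0)"
  by (simp add: dual_def bounded_linear_map_def)

lemma dual_add:
  assumes "f \<in> carr (dual X)" "x \<in> carr X" "y \<in> carr X"
  shows "f (x + y) = f x + f y"
  using assms by (simp add: mem_dual_iff)

lemma dual_smult:
  assumes "f \<in> carr (dual X)" "x \<in> carr X"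
  shows "f (smult X c x) = c * f x"
  using assms by (simp add: mem_dual_iff)

lemma zero_mem_dual: "(\<lambda>_. 0) \<in> carr (dual X)"
  by (auto simp: mem_dual_iff intro: exI[of _ 0])

lemma add_mem_dual:
  assumes f: "f \<in> carr (dual X)" and g: "g \<in> carr (dual X)"
  shows "f + g \<in> carr (dual X)"
proof -
  obtain K L where "\<forall>x\<in>carr X. norm (f x) \<le> K * nrm X x" "\<forall>x\<in>carr X. norm (g x) \<le> L * nrm X x"
    using f g by (auto simp: mem_dual_iff)
  then have "\<forall>x\<in>carr X. norm ((f + g) x) \<le> (K + L) * nrm X x"
    by (auto simp: distrib_right intro: norm_triangle_le add_mono)
  then have "\<exists>K. \<forall>x\<in>carr X. norm ((f + g) x) \<le> K * nrm X x" ..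
  then show ?thesis
    using f g unfolding mem_dual_iff by (simp add: distrib_left add_ac)
qed

lemma smult_mem_dual:
  assumes f: "f \<in> carr (dual X)"
  shows "(\<lambda>x. c * f x) \<in> carr (dual X)"
proof -
  obtain K where "\<forall>x\<in>carr X. norm (f x) \<le> K * nrm X x"
    using f by (auto simp: mem_dual_iff)
  then have "\<forall>x\<in>carr X. norm (c * f x) \<le> (norm c * K) * nrm X x"
    by (auto simp: norm_mult mult.assoc intro: mult_left_mono)
  then have "\<exists>K. \<forall>x\<in>carr X. norm (c * f x) \<le> K * nrm X x" ..
  then show ?thesis
    using f unfolding mem_dual_iff by (simp add: distrib_left mult.left_commute)
qed

lemma norm_le_nrm_dual:
  assumes X: "seminormed X" and f: "f \<in> carr (dual X)"
    and x: "x \<in> carr X" "nrm X x \<le> 1"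
  shows "norm (f x) \<le> nrm (dual X) f"
proof -
  obtain K where K: "\<forall>x\<in>carr X. norm (f x) \<le> K * nrm X x"
    using f by (auto simp: mem_dual_iff)
  have "norm (f y) \<le> \<bar>K\<bar>" if "y \<in> carr X" "nrm X y \<le> 1" for y
  proof -
    have "K * nrm X y \<le> \<bar>K\<bar> * nrm X y"
      using X that by (intro mult_right_mono) (auto simp: seminormed_def)
    also have "\<dots> \<le> \<bar>K\<bar>"
      using that mult_left_mono[of "nrm X y" 1 "\<bar>K\<bar>"] by simp
    finally show ?thesis
      using K that by force
  qed
  then have "bdd_above ((\<lambda>x. norm (f x)) ` {x \<in> carr X. nrm X x \<le> 1})"
    by (intro bdd_aboveI2[where M = "\<bar>K\<bar>"]) auto
  then show ?thesis
    using x by (auto simp: dual_def intro: cSUP_upper)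
qed

lemma unit_ball_nonempty:
  assumes "seminormed X"
  obtains x where "x \<in> carr X" "nrm X x \<le> 1"
proof -
  obtain y where "y \<in> carr X"
    using assms by (auto simp: seminormed_def)
  then show ?thesis
    using assms that[of "smult X 0 y"] by (auto simp: seminormed_def)
qed

lemma nrm_dual_le:
  assumes X: "seminormed X"
    and le: "\<And>x. x \<in> carr X \<Longrightarrow> nrm X x \<le> 1 \<Longrightarrow> norm (f x) \<le> C"
  shows "nrm (dual X) f \<le> C"
  using le unit_ball_nonempty[OF X] by (auto simp: dual_def intro!: cSUP_least)

lemma nrm_dual_nonneg:
  assumes X: "seminormed X" and f: "f \<in> carr (dual X)"
  shows "0 \<le> nrm (dual X) f"
  using unit_ball_nonempty[OF X] norm_le_nrm_dual[OF X f] norm_ge_zero order_trans by metis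

lemma norm_dual_apply_le:
  assumes X: "seminormed X" and f: "f \<in> carr (dual X)" and x: "x \<in> carr X"
  shows "norm (f x) \<le> nrm (dual X) f * nrm X x"
proof (cases "nrm X x = 0")
  case True
  then show ?thesis
    using f x by (auto simp: mem_dual_iff)
next
  case False
  define c :: 'b where "c = of_real (inverse (nrm X x))"
  have pos: "0 < nrm X x"
    using False X x by (auto simp: seminormed_def order_less_le)
  then have c: "norm c = inverse (nrm X x)"
    by (simp add: c_def norm_inverse)
  have "norm (f (smult X c x)) \<le> nrm (dual X) f"
    using X f x c pos by (intro norm_le_nrm_dual) (auto simp: seminormed_def)
  then have "inverse (nrm X x) * norm (f x) \<le> nrm (dual X) f"
    using dual_smult[OF f x] c by (simp add: norm_mult)
  then show ?thesis
    using pos by (simp add: field_simps)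
qed

lemma seminormed_dual:
  assumes X: "seminormed X"
  shows "seminormed (dual X)"
proof -
  have le: "nrm (dual X) (\<lambda>x. c * f x) \<le> norm c * nrm (dual X) f" if "f \<in> carr (dual X)" for c f
    using norm_le_nrm_dual[OF X that]
    by (intro nrm_dual_le[OF X]) (auto simp: norm_mult intro: mult_left_mono)
  \<comment> \<open>The reverse inequality is the same one for the scalar \<open>1 / c\<close> and the functional \<open>c f\<close>.\<close>
  have "nrm (dual X) (\<lambda>x. c * f x) = norm c * nrm (dual X) f" if f: "f \<in> carr (dual X)" for c f
  proof (cases "c = 0")
    case True
    then show ?thesis
      using le[OF f, of c] nrm_dual_nonneg[OF X smult_mem_dual[OF f, of c]] by simp
  next
    case False
    have "nrm (dual X) f \<le> norm (inverse c) * nrm (dual X) (\<lambda>x. c * f x)"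
      using le[OF smult_mem_dual[OF f, of c], of "inverse c"] False
      by (simp add: mult.assoc[symmetric])
    then have "norm c * nrm (dual X) f \<le> nrm (dual X) (\<lambda>x. c * f x)"
      using False mult_left_mono[of "nrm (dual X) f" _ "norm c"]
      by (fastforce simp: norm_inverse mult.assoc[symmetric])
    then show ?thesis
      using le[OF f, of c] by simp
  qed
  then show ?thesis
    using zero_mem_dual[of X] add_mem_dual smult_mem_dual nrm_dual_nonneg[OF X]
    by (auto simp: seminormed_def)
qed

lemma bounded_linear_map_adjoint_map:
  assumes X: "seminormed X" and Y: "seminormed Y" and T: "bounded_linear_map X Y T"
  shows "bounded_linear_map (dual Y) (dual X) (adjoint_map X T)"
proof -
  obtain K where K: "\<forall>x\<in>carr X. nrm Y (T x) \<le> K * nrm X x"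
    using T by (auto simp: bounded_linear_map_def)
  have TY: "T x \<in> carr Y" if "x \<in> carr X" for x
    using T that by (simp add: bounded_linear_map_def)
  have bound: "norm (g (T x)) \<le> (nrm (dual Y) g * \<bar>K\<bar>) * nrm X x"
    if g: "g \<in> carr (dual Y)" and x: "x \<in> carr X" for g x
  proof -
    have "nrm Y (T x) \<le> \<bar>K\<bar> * nrm X x"
    proof (rule order_trans)
      show "nrm Y (T x) \<le> K * nrm X x"
        using K x by blast
      show "K * nrm X x \<le> \<bar>K\<bar> * nrm X x"
        using X x by (intro mult_right_mono) (auto simp: seminormed_def)
    qed
    then have "nrm (dual Y) g * nrm Y (T x) \<le> nrm (dual Y) g * (\<bar>K\<bar> * nrm X x)"
      by (rule mult_left_mono) (rule nrm_dual_nonneg[OF Y g])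
    then show ?thesis
      using norm_dual_apply_le[OF Y g TY[OF x]] by (simp add: mult.assoc)
  qed
  have mem: "adjoint_map X T g \<in> carr (dual X)" if g: "g \<in> carr (dual Y)" for g
    unfolding mem_dual_iff
  proof (intro conjI)
    show "\<forall>x\<in>carr X. \<forall>y\<in>carr X.
        adjoint_map X T g (x + y) = adjoint_map X T g x + adjoint_map X T g y"
      using T X TY dual_add[OF g]
      by (simp add: adjoint_map_def bounded_linear_map_def seminormed_def)
    show "\<forall>c. \<forall>x\<in>carr X. adjoint_map X T g (smult X c x) = c * adjoint_map X T g x"
      using T X TY dual_smult[OF g]
      by (simp add: adjoint_map_def bounded_linear_map_def seminormed_def)
    show "\<exists>L. \<forall>x\<in>carr X. norm (adjoint_map X T g x) \<le> L * nrm X x"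
      using bound[OF g] by (auto simp: adjoint_map_def)
  qed (simp add: adjoint_map_def)
  have "nrm (dual X) (adjoint_map X T g) \<le> \<bar>K\<bar> * nrm (dual Y) g" if g: "g \<in> carr (dual Y)" for g
  proof (rule nrm_dual_le[OF X])
    fix x assume x: "x \<in> carr X" "nrm X x \<le> 1"
    have "(nrm (dual Y) g * \<bar>K\<bar>) * nrm X x \<le> (nrm (dual Y) g * \<bar>K\<bar>) * 1"
      using x nrm_dual_nonneg[OF Y g] by (intro mult_left_mono) auto
    then show "norm (adjoint_map X T g x) \<le> \<bar>K\<bar> * nrm (dual Y) g"
      using bound[OF g x(1)] x(1) by (simp add: adjoint_map_def mult.commute)
  qed
  then have "\<exists>L. \<forall>g\<in>carr (dual Y). nrm (dual X) (adjoint_map X T g) \<le> L * nrm (dual Y) g"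
    by blast
  then show ?thesis
    using mem unfolding bounded_linear_map_def
    by (simp add: adjoint_map_def fun_eq_iff)
qed

section \<open>Weak-star continuous functionals\<close>

lemma openin_initial_topology_basic:
  assumes "\<phi> \<in> F" "open U"
  shows "openin (initial_topology S F) {x \<in> S. \<phi> x \<in> U}"
  unfolding initial_topology_def
  by (rule topology_generated_by_Basis) (use assms in blast)

lemma topspace_initial_topology:
  assumes "F \<noteq> {}"
  shows "topspace (initial_topology S F) = S"
proof
  show "topspace (initial_topology S F) \<subseteq> S"
    by (auto simp: initial_topology_def)
  obtain \<phi> where "\<phi> \<in> F"
    using assms by blast
  then have "openin (initial_topology S F) {x \<in> S. \<phi> x \<in> UNIV}"
    by (rule openin_initial_topology_basic) simp
  then show "S \<subseteq> topspace (initial_topology S F)"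
    using openin_subset by fastforce
qed

text \<open>
  With a point \<open>x\<close>, an initial open set contains all points of \<open>S\<close> at which some finitely many of the
  functions take the same values as at \<open>x\<close>. This weak form of
  the description of basic neighbourhoods is stable under the formation of the topology and is what
  produces a subspace of finite codimension inside a neighbourhood of \<open>0\<close>.
\<close>

lemma initial_topology_finitely_determined:
  assumes "openin (initial_topology S F) U" "x \<in> U"
  shows "\<exists>G\<subseteq>F. finite G \<and> (\<forall>y\<in>S. (\<forall>\<phi>\<in>G. \<phi> y = \<phi> x) \<longrightarrow> y \<in> U)"
proof -
  have "generate_topology_on {{x \<in> S. \<phi> x \<in> U} | \<phi> U. \<phi> \<in> F \<and> open U} U"
    using assms(1) by (simp add: initial_topology_def openin_topology_generated_by_iff)
  then show ?thesis
    using assms(2)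
  proof induction
    case Empty
    then show ?case by simp
  next
    case (Int U V)
    then obtain G H where "G \<subseteq> F" "finite G" "\<forall>y\<in>S. (\<forall>\<phi>\<in>G. \<phi> y = \<phi> x) \<longrightarrow> y \<in> U"
      and "H \<subseteq> F" "finite H" "\<forall>y\<in>S. (\<forall>\<phi>\<in>H. \<phi> y = \<phi> x) \<longrightarrow> y \<in> V"
      by auto
    then show ?case
      by (intro exI[of _ "G \<union> H"]) auto
  next
    case (UN \<U>)
    then obtain U where "U \<in> \<U>" "x \<in> U"
      by blast
    with UN.IH show ?case
      by (meson UnionI)
  next
    case (Basis U)
    then obtain \<phi> V where "U = {x \<in> S. \<phi> x \<in> V}" "\<phi> \<in> F"
      by blast
    with Basis show ?case
      by (intro exI[of _ "{\<phi>}"]) auto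
  qed
qed

text \<open>
  Induction on the number of functionals: if \<open>g\<close> is the new one and \<open>x\<^sub>0\<close> lies in the kernels
  of the old ones, scaled so that \<open>g x\<^sub>0 = 1\<close>, then \<open>\<Phi> - \<Phi>(x\<^sub>0) g\<close> vanishes on the common kernel of the
  old functionals alone, since \<open>x - g(x) x\<^sub>0\<close> lies in the kernel of \<open>g\<close> as well. The functionals are
  evaluations here, so the linear combination is taken among the points of evaluation.
\<close>

lemma vanishing_on_common_kernel_imp_evaluation:
  fixes X :: "('v::ab_group_add, 'k::real_normed_field) nspace"
  assumes "finite G" "G \<subseteq> carr (dual X)"
    and "\<And>x y. x \<in> carr (dual (dual X)) \<Longrightarrow> y \<in> carr (dual (dual X)) \<Longrightarrow> \<Phi> (x + y) = \<Phi> x + \<Phi> y"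
    and "\<And>c x. x \<in> carr (dual (dual X)) \<Longrightarrow> \<Phi> (\<lambda>f. c * x f) = c * \<Phi> x"
    and "\<And>x. x \<in> carr (dual (dual X)) \<Longrightarrow> \<forall>g\<in>G. x g = 0 \<Longrightarrow> \<Phi> x = 0"
  shows "\<exists>f\<in>carr (dual X). \<forall>x\<in>carr (dual (dual X)). \<Phi> x = x f"
  using assms
proof (induction G arbitrary: \<Phi> rule: finite_induct)
  case empty
  have "x (\<lambda>_. 0) = 0" if "x \<in> carr (dual (dual X))" for x
    using dual_smult[OF that zero_mem_dual, of 0] by simp
  then show ?case
    using empty zero_mem_dual[of X] by (intro bexI[of _ "\<lambda>_. 0"]) auto
next
  case (insert g G)
  let ?V = "carr (dual (dual X))"
  have g: "g \<in> carr (dual X)" and G: "G \<subseteq> carr (dual X)"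
    using insert.prems by auto
  show ?case
  proof (cases "\<exists>x\<in>?V. (\<forall>h\<in>G. x h = 0) \<and> x g \<noteq> 0")
    case False
    then show ?thesis
      using insert.prems by (intro insert.IH[OF G]) auto
  next
    case True
    then obtain x1 where x1: "x1 \<in> ?V" "\<forall>h\<in>G. x1 h = 0" "x1 g \<noteq> 0"
      by blast
    define x0 where "x0 = (\<lambda>f. inverse (x1 g) * x1 f)"
    have x0: "x0 \<in> ?V" "\<forall>h\<in>G. x0 h = 0" "x0 g = 1"
      using x1 smult_mem_dual[OF x1(1)] by (auto simp: x0_def)
    have "\<exists>f\<in>carr (dual X). \<forall>x\<in>?V. \<Phi> x - \<Phi> x0 * x g = x f"
    proof (rule insert.IH[OF G])
      fix x assume x: "x \<in> ?V" "\<forall>h\<in>G. x h = 0"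
      let ?y = "x + (\<lambda>f. (- x g) * x0 f)"
      have s: "(\<lambda>f. (- x g) * x0 f) \<in> ?V"
        using smult_mem_dual[OF x0(1)] .
      have "\<Phi> ?y = 0"
      proof (rule insert.prems(4))
        show "?y \<in> ?V"
          by (rule add_mem_dual[OF x(1) s])
        show "\<forall>h\<in>insert g G. ?y h = 0"
          using x x0 by simp
      qed
      moreover have "\<Phi> ?y = \<Phi> x + (- x g) * \<Phi> x0"
        by (simp only: insert.prems(2)[OF x(1) s] insert.prems(3)[OF x0(1)])
      ultimately show "\<Phi> x - \<Phi> x0 * x g = 0"
        by (simp add: mult.commute)
    qed (use insert.prems in \<open>auto simp: algebra_simps\<close>)
    then obtain f where f: "f \<in> carr (dual X)" "\<forall>x\<in>?V. \<Phi> x - \<Phi> x0 * x g = x f"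
      by blast
    have s: "(\<lambda>v. \<Phi> x0 * g v) \<in> carr (dual X)"
      using smult_mem_dual[OF g] .
    have "\<Phi> x = x (f + (\<lambda>v. \<Phi> x0 * g v))" if x: "x \<in> ?V" for x
    proof -
      have "x (f + (\<lambda>v. \<Phi> x0 * g v)) = x f + \<Phi> x0 * x g"
        using dual_smult[OF x g, of "\<Phi> x0"] by (simp only: dual_add[OF x f(1) s] smult_dual)
      also have "x f = \<Phi> x - \<Phi> x0 * x g"
        using f(2) x by simp
      finally have "x (f + (\<lambda>v. \<Phi> x0 * g v)) = \<Phi> x - \<Phi> x0 * x g + \<Phi> x0 * x g" .
      then show ?thesis
        by (simp only: diff_add_cancel)
    qed
    then show ?thesis
      using add_mem_dual[OF f(1) s] by blast
  qed
qed

text \<open>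
  The bound \<open>\<bar>\<Phi>\<bar> < 1\<close> near \<open>0\<close> extends to a whole subspace, hence to all multiples of each of its
  elements, which forces \<open>\<Phi> = 0\<close> there.
\<close>

lemma weak_star_continuous_imp_evaluation:
  fixes X :: "('v::ab_group_add, 'k::real_normed_field) nspace"
  assumes add: "\<And>x y. x \<in> carr (dual (dual X)) \<Longrightarrow> y \<in> carr (dual (dual X)) \<Longrightarrow>
      \<Phi> (x + y) = \<Phi> x + \<Phi> y"
    and scale: "\<And>c x. x \<in> carr (dual (dual X)) \<Longrightarrow> \<Phi> (\<lambda>f. c * x f) = c * \<Phi> x"
    and "openin (weak_star_topology (dual X)) {x \<in> carr (dual (dual X)). \<Phi> x \<in> ball 0 1}"
  shows "\<exists>f\<in>carr (dual X). \<forall>x\<in>carr (dual (dual X)). \<Phi> x = x f"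
proof -
  let ?V = "carr (dual (dual X))"
  let ?U = "{x \<in> ?V. \<Phi> x \<in> ball 0 1}"
  have "\<Phi> (\<lambda>_. 0) = 0"
    using scale[OF zero_mem_dual, of 0] by simp
  then have "(\<lambda>_. 0) \<in> ?U"
    using zero_mem_dual by simp
  from initial_topology_finitely_determined[OF assms(3)[unfolded weak_star_topology_def] this]
  obtain E where E: "E \<subseteq> (\<lambda>f x. x f) ` carr (dual X)" "finite E"
    "\<forall>y\<in>?V. (\<forall>\<phi>\<in>E. \<phi> y = \<phi> (\<lambda>_. 0)) \<longrightarrow> y \<in> ?U"
    by blast
  obtain G where G: "G \<subseteq> carr (dual X)" "finite G" "E = (\<lambda>f x. x f) ` G"
    using finite_subset_image[OF E(2,1)] by blast
  show ?thesis
  proof (rule vanishing_on_common_kernel_imp_evaluation[OF G(2,1) add scale])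
    fix x assume x: "x \<in> ?V" "\<forall>g\<in>G. x g = 0"
    show "\<Phi> x = 0"
    proof (rule ccontr)
      assume nz: "\<Phi> x \<noteq> 0"
      let ?y = "\<lambda>f. inverse (\<Phi> x) * x f"
      have "?y \<in> ?U"
        using E(3) x smult_mem_dual[OF x(1)] by (auto simp: G(3))
      moreover have "\<Phi> ?y = 1"
        using scale[OF x(1), of "inverse (\<Phi> x)"] nz by simp
      ultimately show False
        by simp
    qed
  qed
qed

section \<open>The bidual module action\<close>

lemma bounded_linear_map_adj_right_action:
  assumes M: "banach_bimodule sA sB pi_l pi_r" and z: "z' \<in> carr (dual (whole sB))"
  shows "bounded_linear_map (whole sB) (dual (whole sA)) (adj UNIV pi_r z')"
proof -
  interpret banach_bimodule sA sB pi_l pi_r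
    by (rule M)
  interpret r: bounded_bilinear pi_r
    by (rule bounded_bilinear_r)
  have sA: "seminormed (whole sA)" and sB: "seminormed (whole sB)"
    by (simp_all add: seminormed_whole A.banach_scalars_axioms B.banach_scalars_axioms)
  obtain K where K: "0 \<le> K" "\<And>b a. norm (pi_r b a) \<le> norm b * norm a * K"
    using r.nonneg_bounded by blast
  let ?N = "nrm (dual (whole sB)) z'"
  have N: "0 \<le> ?N"
    by (rule nrm_dual_nonneg[OF sB z])
  have bound: "norm (z' (pi_r b a)) \<le> (?N * K * norm b) * norm a" for b a
    using norm_dual_apply_le[OF sB z, of "pi_r b a"] mult_left_mono[OF K(2) N, of b a]
    by (simp add: mult_ac)
  have mem: "adj UNIV pi_r z' b \<in> carr (dual (whole sA))" for b
    unfolding mem_dual_iff using bound dual_add[OF z] dual_smult[OF z]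
    by (auto simp: adj_def r.add_right pi_r_scale intro!: exI[of _ "?N * K * norm b"])
  have "nrm (dual (whole sA)) (adj UNIV pi_r z' b) \<le> ?N * K * norm b" for b
  proof (rule nrm_dual_le[OF sA])
    fix a assume "nrm (whole sA) a \<le> 1"
    then have "(?N * K * norm b) * norm a \<le> (?N * K * norm b) * 1"
      using N K by (intro mult_left_mono) auto
    then show "norm (adj UNIV pi_r z' b a) \<le> ?N * K * norm b"
      using bound[of b a] by (simp add: adj_def)
  qed
  then have "\<exists>L. \<forall>b\<in>carr (whole sB).
      nrm (dual (whole sA)) (adj UNIV pi_r z' b) \<le> L * nrm (whole sB) b"
    by auto
  then show ?thesis
    using mem dual_add[OF z] dual_smult[OF z] unfolding bounded_linear_map_def
    by (simp add: adj_def fun_eq_iff r.add_left pi_r_scale)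
qed

lemma bidual_right_action_eq:
  "bidual_right_action sA sB pi_r b'' a'' =
     (\<lambda>z'. if z' \<in> carr (dual (whole sB))
           then b'' (adjoint_map (whole sB) (adj UNIV pi_r z') a'') else 0)"
  by (simp add: bidual_right_action_def triple_adj_def adj_def adjoint_map_def fun_eq_iff)

lemma bidual_right_action_linear:
  assumes M: "banach_bimodule sA sB pi_l pi_r"
    and b: "b'' \<in> carr (dual (dual (whole sB)))" and x: "x \<in> carr (dual (dual (whole sA)))"
  shows "y \<in> carr (dual (dual (whole sA))) \<Longrightarrow>
      bidual_right_action sA sB pi_r b'' (x + y) =
        bidual_right_action sA sB pi_r b'' x + bidual_right_action sA sB pi_r b'' y" (is "PROP ?add")
    and "bidual_right_action sA sB pi_r b'' (\<lambda>f. c * x f) =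
        (\<lambda>z'. c * bidual_right_action sA sB pi_r b'' x z')" (is ?scale)
proof -
  interpret banach_bimodule sA sB pi_l pi_r
    by (rule M)
  have T: "bounded_linear_map (dual (dual (whole sA))) (dual (whole sB))
             (adjoint_map (whole sB) (adj UNIV pi_r z'))"
    if "z' \<in> carr (dual (whole sB))" for z'
    by (intro bounded_linear_map_adjoint_map bounded_linear_map_adj_right_action[OF M that]
        seminormed_dual seminormed_whole A.banach_scalars_axioms B.banach_scalars_axioms)
  note T = T[unfolded bounded_linear_map_def]
  have mem: "adjoint_map (whole sB) (adj UNIV pi_r z') w \<in> carr (dual (whole sB))"
    if "z' \<in> carr (dual (whole sB))" "w \<in> carr (dual (dual (whole sA)))" for z' w
    using T[OF that(1)] that(2) by blast
  show "PROP ?add"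
  proof (rule ext)
    fix z' assume y: "y \<in> carr (dual (dual (whole sA)))"
    have "b'' (adjoint_map (whole sB) (adj UNIV pi_r z') (x + y)) =
        b'' (adjoint_map (whole sB) (adj UNIV pi_r z') x) +
        b'' (adjoint_map (whole sB) (adj UNIV pi_r z') y)"
      if z: "z' \<in> carr (dual (whole sB))"
      unfolding dual_add[OF b mem[OF z x] mem[OF z y], symmetric]
      using T[OF z] x y by metis
    then show "bidual_right_action sA sB pi_r b'' (x + y) z' =
        (bidual_right_action sA sB pi_r b'' x + bidual_right_action sA sB pi_r b'' y) z'"
      by (simp add: bidual_right_action_eq)
  qed
  show ?scale
  proof (rule ext)
    fix z'
    have "b'' (adjoint_map (whole sB) (adj UNIV pi_r z') (\<lambda>f. c * x f)) =
        c * b'' (adjoint_map (whole sB) (adj UNIV pi_r z') x)"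
      if z: "z' \<in> carr (dual (whole sB))"
      unfolding dual_smult[OF b mem[OF z x], symmetric]
      using T[OF z] x unfolding smult_dual by metis
    then show "bidual_right_action sA sB pi_r b'' (\<lambda>f. c * x f) z' =
        c * bidual_right_action sA sB pi_r b'' x z'"
      by (simp add: bidual_right_action_eq)
  qed
qed

theorem mainTheorem8:
  fixes sA :: "'k::real_normed_field \<Rightarrow> 'a::{real_normed_algebra, banach} \<Rightarrow> 'a"
    and sB :: "'k \<Rightarrow> 'b::banach \<Rightarrow> 'b"
    and pi_l :: "'a \<Rightarrow> 'b \<Rightarrow> 'b" and pi_r :: "'b \<Rightarrow> 'a \<Rightarrow> 'b"
    and D :: "'a \<Rightarrow> 'b \<Rightarrow> 'k"
  assumes "banach_bimodule sA sB pi_l pi_r"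
    and "Ztilde_l sA sB pi_r = carr (dual (dual (whole sB)))"
    and "derivation_into_dual sA sB pi_l pi_r D"
  shows "{tridual_bidual_prod sA sB pi_r b''' b'' | b''' b''.
            b''' \<in> second_adjoint sA sB D ` carr (dual (dual (whole sA))) \<and>
            b'' \<in> carr (dual (dual (whole sB)))}
         \<subseteq> canonical_embedding (dual (whole sA)) ` carr (dual (whole sA))"
proof -
  interpret banach_bimodule sA sB pi_l pi_r
    by (rule assms(1))
  let ?A2 = "carr (dual (dual (whole sA)))" and ?B2 = "carr (dual (dual (whole sB)))"
  have sA: "seminormed (whole sA)" and sB: "seminormed (whole sB)"
    by (simp_all add: seminormed_whole A.banach_scalars_axioms B.banach_scalars_axioms)
  have "bounded_linear_map (whole sA) (dual (whole sB)) D"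
    using assms(3) by (simp add: derivation_into_dual_def)
  then have "bounded_linear_map (dual (dual (whole sA))) (dual (dual (dual (whole sB))))
      (second_adjoint sA sB D)"
    unfolding second_adjoint_def
    by (intro bounded_linear_map_adjoint_map seminormed_dual sA sB)
  then have D2: "second_adjoint sA sB D u \<in> carr (dual (dual (dual (whole sB))))" if "u \<in> ?A2" for u
    using that by (simp add: bounded_linear_map_def)
  have "tridual_bidual_prod sA sB pi_r b''' b'' \<in>
      canonical_embedding (dual (whole sA)) ` carr (dual (whole sA))"
    if b3: "b''' \<in> carr (dual (dual (dual (whole sB))))" and b2: "b'' \<in> ?B2" for b''' b''
  proof -
    let ?R = "bidual_right_action sA sB pi_r b''"
    have cont: "continuous_map (weak_star_topology (dual (whole sA)))
        (weak_topology (dual (dual (whole sB)))) ?R"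
      using assms(2) b2 by (auto simp: Ztilde_l_def)
    have top_A2: "topspace (weak_star_topology (dual (whole sA))) = ?A2"
      unfolding weak_star_topology_def
      using zero_mem_dual[of "whole sA"] by (intro topspace_initial_topology) blast
    have top_B2: "topspace (weak_topology (dual (dual (whole sB)))) = ?B2"
      unfolding weak_topology_def using b3 by (intro topspace_initial_topology) blast
    have R_mem: "?R x \<in> ?B2" if "x \<in> ?A2" for x
      using continuous_map_image_subset_topspace[OF cont] that top_A2 top_B2 by blast
    have "openin (weak_topology (dual (dual (whole sB)))) {y \<in> ?B2. b''' y \<in> ball 0 1}"
      unfolding weak_topology_def by (rule openin_initial_topology_basic[OF b3]) simp
    from openin_continuous_map_preimage[OF cont this]
    have "openin (weak_star_topology (dual (whole sA))) {x \<in> ?A2. b''' (?R x) \<in> ball 0 1}"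
      using R_mem by (simp add: top_A2 cong: conj_cong)
    moreover have "b''' (?R (x + y)) = b''' (?R x) + b''' (?R y)" if "x \<in> ?A2" "y \<in> ?A2" for x y
      using that bidual_right_action_linear(1)[OF assms(1) b2] dual_add[OF b3] R_mem by simp
    moreover have "b''' (?R (\<lambda>f. c * x f)) = c * b''' (?R x)" if "x \<in> ?A2" for c x
      using that bidual_right_action_linear(2)[OF assms(1) b2] dual_smult[OF b3] R_mem by simp
    ultimately obtain f where "f \<in> carr (dual (whole sA))" "\<forall>x\<in>?A2. b''' (?R x) = x f"
      using weak_star_continuous_imp_evaluation[of "whole sA" "\<lambda>x. b''' (?R x)"] by blast
    then show ?thesis
      by (intro image_eqI[of _ _ f])
        (auto simp: tridual_bidual_prod_def canonical_embedding_def fun_eq_iff)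
  qed
  then show ?thesis
    using D2 by blast
qed

end
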